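(* Let $a>1$ and $k\ge 2$ be integers, and let $T^*=BS^*(a,a+1,\ldots,a+k)$. Then $T^*$ is transmission irregular.
   Context: The transmission of a vertex $v$ of a graph $G$ is ${\rm Tr}_G(v)=\sum_{u\in V(G)} d_G(u,v)$; $G$ is transmission irregular if all its vertices have pairwise different transmissions. The starlike tree $T(a,a+1,\ldots,a+k)$ is the tree obtained by attaching to a single vertex (its center, of degree $k+1$) $k+1$ pendant paths of lengths $a,a+1,\ldots,a+k$. The tree $BS^*(a,a+1,\ldots,a+k)$ is obtained from two disjoint copies of $T(a,a+1,\ldots,a+k)$ by adding an edge joining their two centers, and then attaching one new pendant vertex to one of these two centers (which then has degree $k+3$, the other having degree $k+2$). *)

theory Defs
  imports "Graph_Theory.Graph_Theory"
begin

text \<open>Finite simple graphs are represented as symmetric loop-free digraphs without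
parallel arcs (\<^locale>\<open>pair_graph\<close>), each edge being a pair of opposite arcs.\<close>

text \<open>With unit arc costs the shortest-walk function of the library is the usual distance;
it is infinite between different components.\<close>

definition graph_dist :: "('a, 'b) pre_digraph \<Rightarrow> 'a \<Rightarrow> 'a \<Rightarrow> ereal" where
  "graph_dist G u v = wf_digraph.\<mu> G (\<lambda>_. 1) u v"

definition transmission :: "('a, 'b) pre_digraph \<Rightarrow> 'a \<Rightarrow> ereal" where
  "transmission G v = (\<Sum>u\<in>verts G. graph_dist G u v)"

definition transmission_irregular :: "('a, 'b) pre_digraph \<Rightarrow> bool" where
  "transmission_irregular G \<longleftrightarrow>
     (\<forall>u\<in>verts G. \<forall>v\<in>verts G. u \<noteq> v \<longrightarrow> transmission G u \<noteq> transmission G v)"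


text \<open>\<open>Leg i j\<close> is the vertex at distance \<open>j \<ge> 1\<close> from the center on the \<open>i\<close>-th
pendant path, whose length is the \<open>i\<close>-th list entry.\<close>

datatype starlike_vertex = Center | Leg nat nat

definition leg_at :: "nat \<Rightarrow> nat \<Rightarrow> starlike_vertex" where
  "leg_at i j = (if j = 0 then Center else Leg i j)"

definition starlike :: "nat list \<Rightarrow> starlike_vertex pair_pre_digraph" where
  "starlike ns = mk_symmetric (with_proj
     \<lparr> pverts = {Center} \<union> {Leg i j | i j. i < length ns \<and> 1 \<le> j \<and> j \<le> ns ! i},
       parcs = {(leg_at i j, leg_at i (Suc j)) | i j. i < length ns \<and> j < ns ! i} \<rparr>)"

datatype 'a doubled_vertex = Copy bool 'a | Pendant

definition bs_star :: "nat list \<Rightarrow> starlike_vertex doubled_vertex pair_pre_digraph" where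
  "bs_star ns = mk_symmetric (with_proj
     \<lparr> pverts = {Copy b v | b v. v \<in> pverts (starlike ns)} \<union> {Pendant},
       parcs = {(Copy b u, Copy b v) | b u v. (u, v) \<in> parcs (starlike ns)}
             \<union> {(Copy False Center, Copy True Center), (Copy False Center, Pendant)} \<rparr>)"

lemma parcs_mk_symmetric_with_proj:
  "parcs (mk_symmetric (with_proj G)) = parcs G \<union> (parcs G)\<inverse>"
  by (force simp: mk_symmetric_def)

lemma pverts_starlike:
  "pverts (starlike ns) =
     {Center} \<union> {Leg i j | i j. i < length ns \<and> 1 \<le> j \<and> j \<le> ns ! i}"
  by (simp add: starlike_def mk_symmetric_def)

lemma parcs_starlike:
  "parcs (starlike ns) =
     {(leg_at i j, leg_at i (Suc j)) | i j. i < length ns \<and> j < ns ! i}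
   \<union> {(leg_at i (Suc j), leg_at i j) | i j. i < length ns \<and> j < ns ! i}"
  unfolding starlike_def parcs_mk_symmetric_with_proj by auto

lemma parcs_starlike_sym: "(u, v) \<in> parcs (starlike ns) \<Longrightarrow> (v, u) \<in> parcs (starlike ns)"
  by (auto simp: parcs_starlike)

lemma pverts_bs_star:
  "pverts (bs_star ns) = {Copy b v | b v. v \<in> pverts (starlike ns)} \<union> {Pendant}"
  by (simp add: bs_star_def mk_symmetric_def)

lemma parcs_bs_star:
  "parcs (bs_star ns) =
     {(Copy b u, Copy b v) | b u v. (u, v) \<in> parcs (starlike ns)}
   \<union> {(Copy False Center, Copy True Center), (Copy True Center, Copy False Center),
      (Copy False Center, Pendant), (Pendant, Copy False Center)}"
  (is "_ = ?C \<union> ?D")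
proof -
  have converse_pairs: "(C \<union> {(x, y), (x, z)}) \<union> (C \<union> {(x, y), (x, z)})\<inverse>
      = (C \<union> {(x, y), (y, x), (x, z), (z, x)}) \<union> C\<inverse>" for C :: "'c rel" and x y z
    by auto
  have "parcs (bs_star ns) = (?C \<union> ?D) \<union> ?C\<inverse>"
    unfolding bs_star_def parcs_mk_symmetric_with_proj pair_pre_digraph.simps
    by (rule converse_pairs)
  moreover have "?C\<inverse> \<subseteq> ?C"
    by (auto dest: parcs_starlike_sym)
  ultimately show ?thesis by (simp add: Un_absorb2)
qed

lemma pair_graphI:
  assumes "finite (pverts G)" and "parcs G \<subseteq> pverts G \<times> pverts G"
    and "\<And>u v. (u, v) \<in> parcs G \<Longrightarrow> (v, u) \<in> parcs G"
    and "\<And>u. (u, u) \<notin> parcs G"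
  shows "pair_graph G"
proof -
  have "finite (parcs G)"
    using assms(1,2) by (meson finite_SigmaI finite_subset)
  moreover have "sym (parcs G)"
    using assms(3) by (auto intro: symI)
  ultimately show ?thesis
    using assms by unfold_locales (auto simp: symmetric_def)
qed

lemma pair_graph_starlike: "pair_graph (starlike ns)"
proof (rule pair_graphI)
  have "pverts (starlike ns)
      \<subseteq> {Center} \<union> (\<lambda>(i, j). Leg i j) ` (SIGMA i:{..<length ns}. {..ns ! i})"
    unfolding pverts_starlike by force
  then show "finite (pverts (starlike ns))"
    by (rule finite_subset) auto
qed (auto simp: parcs_starlike pverts_starlike leg_at_def split: if_splits)

lemma pair_graph_bs_star: "pair_graph (bs_star ns)"
proof (rule pair_graphI)
  interpret T: pair_graph "starlike ns" by (rule pair_graph_starlike)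
  have "pverts (bs_star ns)
      = (\<lambda>(b, v). Copy b v) ` (UNIV \<times> pverts (starlike ns)) \<union> {Pendant}"
    unfolding pverts_bs_star by force
  then show "finite (pverts (bs_star ns))"
    by (simp add: T.pair_finite_verts)
  have "Center \<in> pverts (starlike ns)"
    by (simp add: pverts_starlike)
  then show "parcs (bs_star ns) \<subseteq> pverts (bs_star ns) \<times> pverts (bs_star ns)"
    by (auto simp: parcs_bs_star pverts_bs_star dest: T.in_arcsD1 T.in_arcsD2)
  show "(v, u) \<in> parcs (bs_star ns)" if "(u, v) \<in> parcs (bs_star ns)" for u v
    using that by (auto simp: parcs_bs_star dest: parcs_starlike_sym)
  show "(u, u) \<notin> parcs (bs_star ns)" for u
    by (auto simp: parcs_bs_star dest: T.no_loops')
qed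

end

(*
  Moving along an edge of a tree changes the transmission by the difference of the sizes of the
  two sides of the edge. Relative to the center with the pendant vertex, the transmissions are
  therefore 1 at the other center, 2 S + 1 at the pendant vertex, and c + j (2 S + 2 - 2 l + j) at
  depth j on a leg of length l, where S is the sum of the leg lengths and c is 0 or 1 according to
  the copy. For distinct depths the offsets j (2 S + 2 - 2 l + j) differ by at least 2, and for
  equal depths by an even number, so c, j and (unless j = 0) l can be read off. The value 2 S + 1
  lies strictly between the values for j = 1 and those for j = 2.
*)
theory Submission
  imports Defs
begin

section \<open>Distances and transmissions across a bridge\<close>

context fin_digraph
begin

text \<open>Induction on the walk from its end: if the last arc enters \<open>B\<close>, it starts
  at \<open>x\<close> and the rest is a walk to \<open>x\<close>; otherwise the rest already ends in
  \<open>B\<close>, which is why the end point \<open>w\<close> varies in the induction.\<close>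

lemma dist_bridge_le_walk_cost:
  assumes cut: "\<And>p q. p \<rightarrow>\<^bsub>G\<^esub> q \<Longrightarrow> p \<notin> B \<Longrightarrow> q \<in> B \<Longrightarrow> p = x"
    and "awalk u p w" "u \<notin> B" "w \<in> B"
  shows "\<mu> (\<lambda>_. 1) u x + 1 \<le> ereal (awalk_cost (\<lambda>_. 1) p)"
  using assms(2,4)
proof (induction p arbitrary: w rule: rev_induct)
  case Nil
  then show ?case using \<open>u \<notin> B\<close> by (auto simp: awalk_Nil_iff)
next
  case (snoc e p)
  then obtain v where p: "awalk u p v" and e: "awalk v [e] w" by auto
  then have vw: "v \<rightarrow>\<^bsub>G\<^esub> w"
    by (auto simp: awalk_simps intro: in_arcs_imp_in_arcs_ends)
  show ?case
  proof (cases "v \<in> B")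
    case True
    with snoc.IH p have "\<mu> (\<lambda>_. 1) u x + 1 \<le> ereal (awalk_cost (\<lambda>_. 1) p)" by blast
    also have "\<dots> \<le> ereal (awalk_cost (\<lambda>_. 1) (p @ [e]))" by simp
    finally show ?thesis .
  next
    case False
    with cut vw snoc.prems have "v = x" by blast
    with p have "\<mu> (\<lambda>_. 1) u x \<le> ereal (awalk_cost (\<lambda>_. 1) p)"
      by (simp add: min_cost_le_walk_cost)
    then have "\<mu> (\<lambda>_. 1) u x + 1 \<le> ereal (awalk_cost (\<lambda>_. 1) p) + 1"
      by (rule add_right_mono)
    then show ?thesis by (simp add: one_ereal_def)
  qed
qed

lemma graph_dist_across_bridge:
  assumes cut: "\<And>p q. p \<rightarrow>\<^bsub>G\<^esub> q \<Longrightarrow> p \<notin> B \<Longrightarrow> q \<in> B \<Longrightarrow> p = x"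
    and "x \<rightarrow>\<^bsub>G\<^esub> y" "y \<in> B" "u \<notin> B"
  shows "graph_dist G u y = graph_dist G u x + 1"
  unfolding graph_dist_def
proof (rule antisym)
  from \<open>x \<rightarrow>\<^bsub>G\<^esub> y\<close> obtain e where "e \<in> arcs G" "arc_to_ends G e = (x, y)"
    by (auto simp: arcs_ends_def)
  then show "\<mu> (\<lambda>_. 1) u y \<le> \<mu> (\<lambda>_. 1) u x + 1"
    using pos_cost_mu_triangle[of "\<lambda>_. 1" e x y u] by (simp add: one_ereal_def)
  have "\<mu> (\<lambda>_. 1) u x + 1 \<le> ereal (awalk_cost (\<lambda>_. 1) p)" if "awalk u p y" for p
    by (rule dist_bridge_le_walk_cost[OF cut that \<open>u \<notin> B\<close> \<open>y \<in> B\<close>])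
  then show "\<mu> (\<lambda>_. 1) u x + 1 \<le> \<mu> (\<lambda>_. 1) u y"
    unfolding \<mu>_def[of _ u y] by (auto intro: INF_greatest)
qed

end

text \<open>Stepping from \<open>x\<close> to \<open>y\<close> moves one farther from every vertex
  outside \<open>B\<close> and one closer to every vertex in \<open>B\<close>.\<close>

lemma (in graph) transmission_across_bridge:
  assumes cut: "\<And>p q. p \<rightarrow>\<^bsub>G\<^esub> q \<Longrightarrow> p \<notin> B \<Longrightarrow> q \<in> B \<Longrightarrow> p = x \<and> q = y"
    and xy: "x \<rightarrow>\<^bsub>G\<^esub> y" "x \<notin> B" "y \<in> B" and B: "B \<subseteq> verts G"
  shows "transmission G y
    = transmission G x + ereal (of_int (int (card (verts G)) - 2 * int (card B)))"
proof -
  let ?A = "verts G - B"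
  have fin: "finite ?A" "finite B" using B by (auto intro: finite_subset)
  have split: "(\<Sum>u\<in>verts G. f u) = (\<Sum>u\<in>?A. f u) + (\<Sum>u\<in>B. f u)" for f :: "'a \<Rightarrow> ereal"
    using B by (simp add: sum.subset_diff)
  have one: "(\<Sum>u\<in>C. 1) = ereal (of_int (int (card C)))" for C :: "'a set"
    by (simp add: one_ereal_def)
  have out: "graph_dist G u y = graph_dist G u x + 1" if "u \<in> ?A" for u
    by (rule graph_dist_across_bridge[OF _ xy(1,3)]) (use that cut in blast)+
  have "graph_dist G u x = graph_dist G u y + 1" if "u \<in> B" for u
  \<comment> \<open>For sources in \<open>B\<close> the bridge is crossed backwards: by symmetry,
    the complement of \<open>B\<close> can be entered only from \<open>y\<close>.\<close>
  proof (rule graph_dist_across_bridge[of "- B"])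
    show "p = y" if "p \<rightarrow>\<^bsub>G\<^esub> q" "p \<notin> - B" "q \<in> - B" for p q
      using cut[OF graph_symmetric[OF that(1)]] that by blast
  qed (use that xy graph_symmetric[OF xy(1)] in simp_all)
  then have Tx: "transmission G x
      = (\<Sum>u\<in>?A. graph_dist G u x) + ((\<Sum>u\<in>B. graph_dist G u y) + ereal (of_int (int (card B))))"
    unfolding transmission_def split by (simp add: sum.distrib one)
  have Ty: "transmission G y
      = ((\<Sum>u\<in>?A. graph_dist G u x) + ereal (of_int (int (card ?A)))) + (\<Sum>u\<in>B. graph_dist G u y)"
    unfolding transmission_def split using out by (simp add: sum.distrib one)
  have "card ?A + card B = card (verts G)"
    using B fin by (metis card_Diff_subset card_mono finite_verts le_add_diff_inverse2)
  then have "int (card (verts G)) = int (card ?A) + int (card B)" by simp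
  then show ?thesis unfolding Tx Ty
    \<comment> \<open>The sums may be infinite; an infinite one absorbs the finite terms on both
      sides.\<close>
    by (cases "\<Sum>u\<in>?A. graph_dist G u x"; cases "\<Sum>u\<in>B. graph_dist G u y") auto
qed

section \<open>Vertex counts and coordinates\<close>

lemma card_pverts_starlike: "card (pverts (starlike ns)) = Suc (sum_list ns)"
proof -
  let ?L = "(\<lambda>(i, j). Leg i j) ` (SIGMA i:{..<length ns}. {1..ns ! i})"
  have "pverts (starlike ns) = insert Center ?L"
    unfolding pverts_starlike by force
  moreover have "card ?L = sum_list ns"
    by (subst card_image)
      (auto simp: inj_on_def sum_list_sum_nth atLeast0LessThan)
  ultimately show ?thesis by (simp add: image_iff split: prod.splits)
qed

lemma card_pverts_bs_star: "card (pverts (bs_star ns)) = 2 * sum_list ns + 3"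
proof -
  have fin: "finite (pverts (starlike ns))"
  proof -
    interpret pair_graph "starlike ns" by (rule pair_graph_starlike)
    show ?thesis by (rule pair_finite_verts)
  qed
  let ?C = "(\<lambda>(b, v). Copy b v) ` (UNIV \<times> pverts (starlike ns))"
  have "pverts (bs_star ns) = insert Pendant ?C"
    unfolding pverts_bs_star by force
  moreover have "card ?C = 2 * Suc (sum_list ns)"
    by (subst card_image) (auto simp: inj_on_def card_cartesian_product card_pverts_starlike)
  ultimately show ?thesis using fin by (simp add: image_iff)
qed

text \<open>The centers count as depth 0 of a leg, which presupposes that some leg exists; index 0
  serves as witness.\<close>

lemma pverts_bs_star_cases:
  assumes "v \<in> pverts (bs_star ns)" and "ns \<noteq> []"
  obtains "v = Pendant"
  | b i j where "v = Copy b (leg_at i j)" "i < length ns" "j \<le> ns ! i"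
proof -
  have "\<exists>i j. w = leg_at i j \<and> i < length ns \<and> j \<le> ns ! i" if w: "w \<in> pverts (starlike ns)" for w
  proof (cases w)
    case Center
    with \<open>ns \<noteq> []\<close> show ?thesis by (intro exI[of _ 0]) (simp add: leg_at_def)
  next
    case (Leg i j)
    with w show ?thesis by (intro exI[of _ i] exI[of _ j]) (auto simp: leg_at_def pverts_starlike)
  qed
  then show thesis using assms(1) that by (force simp: pverts_bs_star)
qed

section \<open>Transmissions relative to the center with the pendant vertex\<close>

context
  fixes ns :: "nat list"
begin

interpretation pair_graph "bs_star ns" by (rule pair_graph_bs_star)

lemma transmission_Pendant:
  "transmission (bs_star ns) Pendant
    = transmission (bs_star ns) (Copy False Center) + ereal (of_int (2 * int (sum_list ns) + 1))"
  using transmission_across_bridge[of "{Pendant}" "Copy False Center" Pendant]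
  by (simp add: parcs_bs_star card_pverts_bs_star add.commute) (auto simp: pverts_bs_star)

lemma transmission_other_center:
  "transmission (bs_star ns) (Copy True Center)
    = transmission (bs_star ns) (Copy False Center) + ereal (of_int 1)"
proof -
  interpret T: pair_graph "starlike ns" by (rule pair_graph_starlike)
  let ?B = "Copy True ` pverts (starlike ns)"
  have "transmission (bs_star ns) (Copy True Center) = transmission (bs_star ns) (Copy False Center)
      + ereal (of_int (int (card (pverts (bs_star ns))) - 2 * int (card ?B)))"
    by (rule transmission_across_bridge)
      (auto simp: parcs_bs_star pverts_bs_star pverts_starlike[THEN eqset_imp_iff, of Center]
        dest: T.in_arcsD1 T.in_arcsD2)
  moreover have "card ?B = Suc (sum_list ns)"
    by (subst card_image) (auto simp: inj_on_def card_pverts_starlike)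
  ultimately show ?thesis by (simp add: card_pverts_bs_star)
qed

text \<open>The edge cuts off the outer part of the leg, at depths \<open>j + 1\<close> to
  \<open>ns ! i\<close>, from a tree with \<open>2 * sum_list ns + 3\<close> vertices.\<close>

lemma transmission_leg_at_Suc:
  assumes i: "i < length ns" and j: "j < ns ! i"
  shows "transmission (bs_star ns) (Copy b (leg_at i (Suc j)))
    = transmission (bs_star ns) (Copy b (leg_at i j))
      + ereal (of_int (2 * int (sum_list ns) + 3 - 2 * (int (ns ! i) - int j)))"
proof -
  let ?B = "(\<lambda>m. Copy b (Leg i m)) ` {j<..ns ! i}"
  have "transmission (bs_star ns) (Copy b (leg_at i (Suc j)))
    = transmission (bs_star ns) (Copy b (leg_at i j))
      + ereal (of_int (int (card (pverts (bs_star ns))) - 2 * int (card ?B)))"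
    by (rule transmission_across_bridge)
      (use i j in \<open>auto simp: parcs_bs_star pverts_bs_star parcs_starlike pverts_starlike leg_at_def
        image_iff split: if_splits\<close>)
  moreover have "card ?B = ns ! i - j" by (subst card_image) (auto simp: inj_on_def)
  ultimately show ?thesis using j by (simp add: card_pverts_bs_star of_nat_diff)
qed

text \<open>With S the sum and l the length of the leg, the increments 2 S + 3 - 2 l + 2 m for m < j
  add up to j (2 S + 2 - 2 l + j); the start value \<open>of_bool b\<close> belongs to the center of
  the copy.\<close>

lemma transmission_leg_at:
  assumes i: "i < length ns" and "j \<le> ns ! i"
  shows "transmission (bs_star ns) (Copy b (leg_at i j))
    = transmission (bs_star ns) (Copy False Center)
      + ereal (of_int (of_bool b
          + int j * (2 * int (sum_list ns) + 2 - 2 * int (ns ! i) + int j)))"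
  using assms(2)
proof (induction j)
  case 0
  then show ?case using transmission_other_center by (cases b) (simp_all add: leg_at_def)
next
  case (Suc j)
  then have "transmission (bs_star ns) (Copy b (leg_at i (Suc j)))
    = transmission (bs_star ns) (Copy False Center)
      + (ereal (of_int (of_bool b
          + int j * (2 * int (sum_list ns) + 2 - 2 * int (ns ! i) + int j)))
      + ereal (of_int (2 * int (sum_list ns) + 3 - 2 * (int (ns ! i) - int j))))"
    using transmission_leg_at_Suc[OF i, of j b]
    by (simp only: Suc_leD Suc_le_lessD add.assoc)
  then show ?case by (simp add: algebra_simps)
qed

text \<open>This excludes infinite distances to the reference center, so that its transmission can
  later be cancelled.\<close>

lemma reachable_center:
  assumes "v \<in> pverts (bs_star ns)" "ns \<noteq> []"
  shows "v \<rightarrow>\<^sup>*\<^bsub>bs_star ns\<^esub> Copy False Center"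
  using assms
proof (cases rule: pverts_bs_star_cases)
  case 1
  then show ?thesis by (auto intro!: reachable_adjI simp: parcs_bs_star)
next
  case (2 b i j)
  have c: "Copy b Center \<rightarrow>\<^sup>*\<^bsub>bs_star ns\<^esub> Copy False Center" for b
    by (cases b) (auto intro: reachable_adjI simp: parcs_bs_star pverts_bs_star pverts_starlike)
  have "Copy b (leg_at i j) \<rightarrow>\<^sup>*\<^bsub>bs_star ns\<^esub> Copy False Center"
    using \<open>j \<le> ns ! i\<close>
  proof (induction j)
    case 0
    then show ?case using c by (simp add: leg_at_def)
  next
    case (Suc j)
    have "(leg_at i (Suc j), leg_at i j) \<in> parcs (starlike ns)"
      using Suc.prems \<open>i < length ns\<close> unfolding parcs_starlike Suc_le_eq by blast
    then have "(Copy b (leg_at i (Suc j)), Copy b (leg_at i j)) \<in> parcs (bs_star ns)"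
      unfolding parcs_bs_star by blast
    then show ?case using Suc by (auto intro: adj_reachable_trans)
  qed
  then show ?thesis using 2 by simp
qed

lemma transmission_center_finite:
  assumes "ns \<noteq> []"
  shows "\<bar>transmission (bs_star ns) (Copy False Center)\<bar> \<noteq> \<infinity>"
proof -
  have "\<bar>graph_dist (bs_star ns) u (Copy False Center)\<bar> \<noteq> \<infinity>" if u: "u \<in> pverts (bs_star ns)" for u
  proof -
    obtain p where "graph_dist (bs_star ns) u (Copy False Center) = ereal (awalk_cost (\<lambda>_. 1) p)"
      unfolding graph_dist_def
      using min_cost_awalk[OF reachable_center[OF u assms], of "\<lambda>_. 1"] by auto
    then show ?thesis by simp
  qed
  then show ?thesis unfolding transmission_def
    by (simp add: sum_Inf)
qed

end

section \<open>Integer arithmetic separating the offsets\<close>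

text \<open>The difference of the two offsets is (j - j') Q - 2 (l - l') j' with \<open>Q\<close> as
  defined in the proof. As j - j' is at least 1 and \<open>Q\<close> is nonnegative, it suffices
  that \<open>Q\<close> exceeds 2 (l - l') j' by 2.\<close>

lemma offset_gap:
  fixes a k l l' j j' S :: int
  assumes S: "2 * S = (k + 1) * (2 * a + k)" and "0 \<le> a"
    and l: "a \<le> l" "l \<le> a + k" and l': "a \<le> l'" "l' \<le> a + k"
    and j: "0 \<le> j'" "j' < j" "j' \<le> l'"
  shows "j' * (2 * S + 2 - 2 * l' + j') + 2 \<le> j * (2 * S + 2 - 2 * l + j)"
proof -
  define t where "t = l' - a"
  define Q where "Q = 2 * S + 2 - 2 * l + j + j'"
  have t: "0 \<le> t" "t \<le> k" using l' by (auto simp: t_def)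
  have sq: "n \<le> n * n" if "0 \<le> n" for n :: int
    using that by (cases "n = 0") (auto simp: mult_le_cancel_left1)
  have "k \<le> (k - t) * (k - t) + t * t" using sq[of t] sq[of "k - t"] t by linarith
  moreover have "0 \<le> t * a" using t \<open>0 \<le> a\<close> by simp
  moreover have "2 * S = 2 * k * a + k * k + 2 * a + k"
    using S by (simp add: algebra_simps)
  \<comment> \<open>By l <= a + k and j + j' >= 1, the right side minus the left is at least (k -
    t)^2 + t^2 - k + 2 t a + 1.\<close>
  ultimately have Q: "2 * ((k - t) * (a + t)) + 2 \<le> Q"
    using l j unfolding Q_def by (simp add: algebra_simps)
  have drift: "2 * ((l - l') * j') + 2 \<le> Q"
  proof (cases "l' \<le> l")
    case True
    \<comment> \<open>Here l - l' <= k - t, and j' <= l' = a + t.\<close>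
    have "(l - l') * j' \<le> (k - t) * (a + t)"
      using l l' j t \<open>0 \<le> a\<close> True by (intro mult_mono) (auto simp: t_def)
    with Q show ?thesis by linarith
  next
    case False
    then have "(l - l') * j' \<le> 0" using j by (simp add: mult_nonpos_nonneg)
    moreover have "0 \<le> (k - t) * (a + t)" using t \<open>0 \<le> a\<close> by simp
    ultimately show ?thesis using Q by linarith
  qed
  have "0 \<le> Q" using Q t \<open>0 \<le> a\<close> by (smt (verit) mult_nonneg_nonneg)
  then have "1 * Q \<le> (j - j') * Q" using j by (intro mult_right_mono) auto
  moreover have "j * (2 * S + 2 - 2 * l + j) - j' * (2 * S + 2 - 2 * l' + j')
      = (j - j') * Q - 2 * ((l - l') * j')"
    by (simp add: Q_def algebra_simps)
  ultimately show ?thesis using drift by linarith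
qed

text \<open>A gap of 2 between different depths cannot be bridged by the copy bits; at equal depths
  parity separates the bits, and j (l - l') = 0 remains. The exception \<open>j = 0\<close> is the
  center, shared by all legs.\<close>

lemma offset_inj:
  fixes a k l l' j j' S :: int
  assumes S: "2 * S = (k + 1) * (2 * a + k)" and "0 \<le> a"
    and l: "a \<le> l" "l \<le> a + k" and l': "a \<le> l'" "l' \<le> a + k"
    and j: "0 \<le> j" "j \<le> l" and j': "0 \<le> j'" "j' \<le> l'"
    and eq: "of_bool b + j * (2 * S + 2 - 2 * l + j) = of_bool b' + j' * (2 * S + 2 - 2 * l' + j')"
  shows "b = b' \<and> j = j' \<and> (j = 0 \<or> l = l')"
proof -
  have bound: "(0::int) \<le> of_bool c" "of_bool c \<le> (1::int)" for c by auto
  have jj: "j = j'"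
  proof (rule linorder_cases[of j j'])
    assume "j < j'"
    from offset_gap[OF S \<open>0 \<le> a\<close> l' l j(1) this j(2)] eq bound[of b] bound[of b']
    show ?thesis by linarith
  next
    assume "j' < j"
    from offset_gap[OF S \<open>0 \<le> a\<close> l l' j'(1) this j'(2)] eq bound[of b] bound[of b']
    show ?thesis by linarith
  qed
  with eq have diff: "of_bool b - of_bool b' = 2 * (j * (l - l'))"
    by (simp add: algebra_simps)
  then have "even (of_bool b - of_bool b' :: int)" by simp
  then have bb: "b = b'" by (cases b; cases b') auto
  with diff jj show ?thesis by auto
qed

lemma offset_neq_pendant:
  fixes a k l j S :: int
  assumes S: "2 * S = (k + 1) * (2 * a + k)" and "1 < a" "2 \<le> k"
    and l: "a \<le> l" "l \<le> a + k" and "0 \<le> j"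
  shows "of_bool b + j * (2 * S + 2 - 2 * l + j) \<noteq> 2 * S + 1"
proof -
  have bound: "(0::int) \<le> of_bool b" "of_bool b \<le> (1::int)" by auto
  \<comment> \<open>By l <= a + k, 2 S + 2 - 4 l is at least 2 (k - 1) a + (k - 2)(k - 1); these two
    facts make that nonnegative.\<close>
  have "2 * a \<le> k * a" "0 \<le> (k - 2) * (k - 1)" using assms by auto
  moreover have "(k - 2) * (k - 1) = k * k - 3 * k + 2" by (simp add: algebra_simps)
  moreover have "2 * S = 2 * (k * a) + k * k + 2 * a + k"
    using S by (simp add: algebra_simps)
  ultimately have S_large: "4 * l \<le> 2 * S + 2" "0 < S"
    using l \<open>1 < a\<close> \<open>2 \<le> k\<close> by linarith+
  consider "j = 0" | "j = 1" | "2 \<le> j" using \<open>0 \<le> j\<close> by linarith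
  then show ?thesis
  proof cases
    case 3
    then have "2 * (2 * S + 2 - 2 * l + 2) \<le> j * (2 * S + 2 - 2 * l + j)"
      using S_large l \<open>1 < a\<close> by (intro mult_mono) auto
    moreover have "2 * S + 1 < 2 * (2 * S + 2 - 2 * l + 2)" using S_large by simp
    ultimately have "2 * S + 1 < j * (2 * S + 2 - 2 * l + j)" by (rule less_le_trans[rotated])
    then have "2 * S + 1 < of_bool b + j * (2 * S + 2 - 2 * l + j)"
      using bound(1) by (rule add_strict_increasing2[rotated])
    then show ?thesis by simp
  \<comment> \<open>For \<open>j = 0\<close> the value is at most 1 < 2 S + 1. For
    \<open>j = 1\<close> it is at most 2 S + 4 - 2 l, which is at most 2 S because l >= a >=
    2.\<close>
  qed (use S_large bound l \<open>1 < a\<close> in auto)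
qed

section \<open>Consecutive leg lengths and transmission irregularity\<close>

lemma sum_list_upt_consecutive:
  "2 * int (sum_list [a..<a + k + 1]) = (int k + 1) * (2 * int a + int k)"
  by (induction k) (simp_all add: algebra_simps)

theorem theorem3p6:
  fixes a k :: nat
  assumes "a > 1" and "k \<ge> 2"
  shows "transmission_irregular (with_proj (bs_star [a..<a + k + 1]))"
  unfolding transmission_irregular_def
proof (intro ballI impI notI)
  define ns where "ns = [a..<a + k + 1]"
  let ?T = "transmission (bs_star ns)"
  let ?S = "int (sum_list ns)"
  have ne: "ns \<noteq> []" by (simp add: ns_def)
  have S: "2 * ?S = (int k + 1) * (2 * int a + int k)"
    unfolding ns_def by (rule sum_list_upt_consecutive)
  have leg: "ns ! i = a + i" "int a \<le> int (ns ! i)" "int (ns ! i) \<le> int a + int k"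
    if "i < length ns" for i
    using that by (auto simp: ns_def simp del: upt_Suc)
  \<comment> \<open>A real reference value can be cancelled, reducing equal transmissions to equal
    integer offsets.\<close>
  obtain T0 where T0: "?T (Copy False Center) = ereal T0"
    using transmission_center_finite[OF ne] by auto
  have pendant: "?T (Copy b (leg_at i j)) \<noteq> ?T Pendant"
    if "i < length ns" "j \<le> ns ! i" for b i j
    using offset_neq_pendant[OF S _ _ leg(2,3)[OF that(1)], of "int j" b] assms
    unfolding transmission_leg_at[OF that] transmission_Pendant T0 by (simp del: of_int_add of_int_mult of_int_diff)
  fix u v
  assume "u \<in> verts (bs_star [a..<a + k + 1])" "v \<in> verts (bs_star [a..<a + k + 1])"
    and "u \<noteq> v" "transmission (bs_star [a..<a + k + 1]) u = transmission (bs_star [a..<a + k + 1]) v"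
  then have u: "u \<in> pverts (bs_star ns)" and v: "v \<in> pverts (bs_star ns)"
    and T: "?T u = ?T v" by (simp_all add: ns_def)
  show False
  proof (cases rule: pverts_bs_star_cases[OF u ne])
    case 1
    show ?thesis
      by (cases rule: pverts_bs_star_cases[OF v ne]) (use 1 T \<open>u \<noteq> v\<close> pendant in metis)+
  next
    case u: (2 b i j)
    show ?thesis
    proof (cases rule: pverts_bs_star_cases[OF v ne])
      case 1
      with u T pendant show ?thesis by metis
    next
      case v: (2 b' i' j')
      have "of_bool b + int j * (2 * ?S + 2 - 2 * int (ns ! i) + int j)
          = of_bool b' + int j' * (2 * ?S + 2 - 2 * int (ns ! i') + int j')"
        using T unfolding u(1) v(1) transmission_leg_at[OF u(2,3)] transmission_leg_at[OF v(2,3)] T0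
        by (simp only: plus_ereal.simps ereal.inject add_left_cancel of_int_eq_iff)
      \<comment> \<open>Since \<open>ns ! i = a + i\<close>, equal leg lengths mean equal indices;
        at depth 0 the index does not affect \<open>leg_at\<close>.\<close>
      from offset_inj[OF S _ leg(2,3)[OF u(2)] leg(2,3)[OF v(2)] _ _ _ _ this] u v leg(1)
      have "b = b'" "j = j'" "j = 0 \<or> i = i'" by auto
      with u v \<open>u \<noteq> v\<close> show ?thesis by (auto simp: leg_at_def)
    qed
  qed
qed

end
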